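(* Let $T>0$ and let $c:[0,T]\to\mathbb{R}$ be Lipschitz and satisfy $c(T)=0$ and $-c'\in[0,1]$ a.e. Then $$u_c(t,x):=\mathbf{1}\{x\le c(t)\}$$ is a solution of $$-\partial_tu+u\,\partial_xu=0\ \text{ in }(0,T)\times\mathbb{R},\qquad u(T,x)=\mathbf{1}\{x\le0\}.$$
   Context: Definition of solution. A locally bounded function $u:[0,T]\times\mathbb{R}\to\mathbb{R}$, nonincreasing in $x$ and with $u(t,x)/(1+|x|)\in L^\infty$, is a solution of $-\partial_tu+u\,\partial_xu=0$, $u(T,\cdot)=u_T$, if it is the solution of the linear transport equation $-\partial_tu-b(t,x)\partial_xu=0$, $u(T,\cdot)=u_T$, with $b(t,x)=-u(t,x)$. The solution of the linear equation with $b(t,\cdot)$ nondecreasing and of at most linear growth is the function given, for every $t\in[0,T]$ and a.e. $x$, by $u(t,x)=u_T(\phi_{T,t}(x))$, where $\phi$ is the regular Lagrangian flow of $b$: for every $s\in[0,T]$ and a.e. $x$, $[s,T]\ni t\mapsto\phi_{t,s}(x)$ is the unique absolutely continuous solution of $\partial_t\phi_{t,s}(x)\in[b_*(t,\phi_{t,s}(x)),b^*(t,\phi_{t,s}(x))]$ for a.e. $t$, $\phi_{s,s}(x)=x$, with $b_*,b^*$ the lower/upper semicontinuous envelopes of $b(t,\cdot)$ in $x$. Equivalently (for decreasing terminal data), for a smooth nonnegative $\rho$ supported in $[-1,1]$ with $\int\rho=1$, $\rho_\varepsilon(z)=\varepsilon^{-1}\rho(\frac{z-\varepsilon}{\varepsilon})$,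 $\rho^\varepsilon(z)=\varepsilon^{-1}\rho(\frac{z+\varepsilon}{\varepsilon})$, the functions $u_\varepsilon=u*\rho_\varepsilon$ and $u^\varepsilon=u*\rho^\varepsilon$ (convolution in $x$, absolutely continuous in $t$) satisfy $-\partial_tu_\varepsilon+u\,\partial_xu_\varepsilon\ge0$ and $-\partial_tu^\varepsilon+u\,\partial_xu^\varepsilon\le0$ for a.e. $(t,x)$, and $u(T,\cdot)=u_T$. *)

theory Defs
  imports "HOL-Analysis.Analysis"
begin

text \<open>Lower and upper semicontinuous envelopes. The filter \<open>nhds x\<close> includes the point \<open>x\<close> itself;
  the values are extended reals, since an arbitrary real function may be locally unbounded.\<close>

definition lsc_env :: "(real \<Rightarrow> real) \<Rightarrow> real \<Rightarrow> ereal" where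
  "lsc_env f x = Liminf (nhds x) (\<lambda>y. ereal (f y))"

definition usc_env :: "(real \<Rightarrow> real) \<Rightarrow> real \<Rightarrow> ereal" where
  "usc_env f x = Limsup (nhds x) (\<lambda>y. ereal (f y))"

text \<open>The usual \<open>\<epsilon>\<close>-\<open>\<delta>\<close> notion; \<open>D\<close> ranges over the finite families of non-overlapping compact
  subintervals \<open>K = [Inf K, Sup K]\<close> of \<open>[a, b]\<close>.\<close>

definition abs_continuous_on_interval :: "real \<Rightarrow> real \<Rightarrow> (real \<Rightarrow> real) \<Rightarrow> bool" where
  "abs_continuous_on_interval a b f \<longleftrightarrow>
     (\<forall>\<epsilon>>0. \<exists>\<delta>>0. \<forall>D. D division_of \<Union>D \<and> \<Union>D \<subseteq> {a..b} \<and> (\<Sum>K\<in>D. Sup K - Inf K) < \<delta>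
        \<longrightarrow> (\<Sum>K\<in>D. \<bar>f (Sup K) - f (Inf K)\<bar>) < \<epsilon>)"

text \<open>\<open>\<gamma>\<close> is an absolutely continuous solution on \<open>[s, T]\<close> of
  \<open>\<gamma>'(t) \<in> [b\<^sub>*(t, \<gamma>(t)), b\<^sup>*(t, \<gamma>(t))]\<close> for a.e. \<open>t\<close>, with \<open>\<gamma>(s) = x\<close>.\<close>

definition inclusion_solution ::
  "real \<Rightarrow> (real \<Rightarrow> real \<Rightarrow> real) \<Rightarrow> real \<Rightarrow> real \<Rightarrow> (real \<Rightarrow> real) \<Rightarrow> bool" where
  "inclusion_solution T b s x \<gamma> \<longleftrightarrow>
     abs_continuous_on_interval s T \<gamma> \<and> \<gamma> s = x \<and>
     (AE t in lebesgue_on {s..T}. \<exists>v. (\<gamma> has_real_derivative v) (at t) \<and>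
        lsc_env (b t) (\<gamma> t) \<le> ereal v \<and> ereal v \<le> usc_env (b t) (\<gamma> t))"

text \<open>\<open>\<phi> t s x\<close> is the position at time \<open>t\<close> of the trajectory started from \<open>x\<close> at time \<open>s\<close>.\<close>

definition regular_lagrangian_flow ::
  "real \<Rightarrow> (real \<Rightarrow> real \<Rightarrow> real) \<Rightarrow> (real \<Rightarrow> real \<Rightarrow> real \<Rightarrow> real) \<Rightarrow> bool" where
  "regular_lagrangian_flow T b \<phi> \<longleftrightarrow>
     (\<forall>s\<in>{0..T}. AE x in lebesgue.
        inclusion_solution T b s x (\<lambda>t. \<phi> t s x) \<and>
        (\<forall>\<gamma>. inclusion_solution T b s x \<gamma> \<longrightarrow> (\<forall>t\<in>{s..T}. \<gamma> t = \<phi> t s x)))"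

text \<open>\<open>f(t, x) / (1 + |x|) \<in> L\<^sup>\<infinity>([0, T] \<times> \<real>)\<close>\<close>

definition linear_growth :: "real \<Rightarrow> (real \<Rightarrow> real \<Rightarrow> real) \<Rightarrow> bool" where
  "linear_growth T f \<longleftrightarrow>
     (\<lambda>(t, x). f t x / (1 + \<bar>x\<bar>)) \<in> borel_measurable (lebesgue_on ({0..T} \<times> UNIV)) \<and>
     (\<exists>C. AE (t, x) in lebesgue_on ({0..T} \<times> UNIV). \<bar>f t x / (1 + \<bar>x\<bar>)\<bar> \<le> C)"

definition locally_bounded :: "real \<Rightarrow> (real \<Rightarrow> real \<Rightarrow> real) \<Rightarrow> bool" where
  "locally_bounded T f \<longleftrightarrow>
     (\<forall>K. compact K \<and> K \<subseteq> {0..T} \<times> UNIV \<longrightarrow> bounded ((\<lambda>(t, x). f t x) ` K))"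

text \<open>\<open>u\<close> is the solution of \<open>- \<partial>\<^sub>t u - b \<partial>\<^sub>x u = 0\<close>, \<open>u(T, \<cdot>) = u\<^sub>T\<close>. The terminal condition is the
  case \<open>t = T\<close> of the representation formula, because \<open>\<phi> T T x = x\<close>.\<close>

definition transport_solution ::
  "real \<Rightarrow> (real \<Rightarrow> real \<Rightarrow> real) \<Rightarrow> (real \<Rightarrow> real) \<Rightarrow> (real \<Rightarrow> real \<Rightarrow> real) \<Rightarrow> bool" where
  "transport_solution T b u\<^sub>T u \<longleftrightarrow>
     (\<forall>t\<in>{0..T}. mono (b t)) \<and> linear_growth T b \<and>
     (\<exists>\<phi>. regular_lagrangian_flow T b \<phi> \<and>
        (\<forall>t\<in>{0..T}. AE x in lebesgue. u t x = u\<^sub>T (\<phi> T t x)))"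

text \<open>\<open>u\<close> is a solution of \<open>- \<partial>\<^sub>t u + u \<partial>\<^sub>x u = 0\<close>, \<open>u(T, \<cdot>) = u\<^sub>T\<close>.\<close>

definition burgers_solution ::
  "real \<Rightarrow> (real \<Rightarrow> real) \<Rightarrow> (real \<Rightarrow> real \<Rightarrow> real) \<Rightarrow> bool" where
  "burgers_solution T u\<^sub>T u \<longleftrightarrow>
     locally_bounded T u \<and> (\<forall>t\<in>{0..T}. antimono (u t)) \<and> linear_growth T u \<and>
     transport_solution T (\<lambda>t x. - u t x) u\<^sub>T u"

end

theory Submission
  imports Defs
begin

text \<open>
  The velocity field \<open>b(t, x) = -1{x \<le> c(t)}\<close> takes the value \<open>0\<close> to the right of the front
  \<open>x = c(t)\<close> and \<open>-1\<close> to its left, while the front itself moves with a speed in \<open>[-1, 0]\<close>. Hence a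
  particle that starts strictly to the right of the front and stays at rest is never caught, since
  \<open>c\<close> is nonincreasing, and a particle that starts strictly to the left and moves with velocity
  \<open>-1\<close> never falls behind the front, since \<open>t \<mapsto> c(t) + t\<close> is nondecreasing. These trajectories form
  the regular Lagrangian flow; the only starting point that is excluded at time \<open>s\<close> is \<open>c(s)\<close>, a
  null set. Since \<open>c(T) = 0\<close>, the flow sends the points to the left of \<open>c(t)\<close> at time \<open>t\<close> to negative
  positions at time \<open>T\<close> and those to the right to positive ones, which is the representation formula
  \<open>u(t, x) = 1{\<phi>(T, t, x) \<le> 0}\<close>.

  The substance is uniqueness: an arbitrary solution of the differential inclusion has to be compared
  with this flow although the inclusion says little where the solution meets the front. It turns out
  that the front is never met. Let a solution start strictly to the right at time \<open>s\<close>.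
  As long as it stays to the right of the fixed level \<open>c(s)\<close>, it is also to the right of \<open>c(t)\<close>, so its
  derivative vanishes a.e. and it is constant; by continuity it cannot reach the level \<open>c(s)\<close>. On the
  left the same argument works with the line \<open>c(s) - (t - s)\<close>. These barrier arguments are
  \<open>abs_continuous_stays_above_line\<close> and \<open>abs_continuous_stays_below_line\<close>.

  Both the barrier argument and the passage from the a.e. bounds on \<open>c'\<close> to bounds on the increments
  of \<open>c\<close> rest on one fact of real analysis: if an absolutely continuous function has derivative at
  most \<open>k\<close> almost everywhere, its increments are at most \<open>k\<close> times the length of the interval
  (\<open>abs_continuous_increment_le\<close>). It is obtained with tagged divisions that are fine for a suitable
  gauge, without Lebesgue's differentiation theorem or the Vitali covering theorem.
\<close>

section \<open>Absolutely continuous functions on an interval\<close>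

lemma abs_continuous_on_interval_subset:
  assumes "abs_continuous_on_interval a b f" "a \<le> a'" "b' \<le> b"
  shows "abs_continuous_on_interval a' b' f"
proof -
  have "{a'..b'} \<subseteq> {a..b}"
    using assms by auto
  with assms(1) show ?thesis
    unfolding abs_continuous_on_interval_def by (meson order_trans)
qed

lemma abs_continuous_on_intervalE:
  assumes "abs_continuous_on_interval a b f" "0 < e"
  obtains d where "d > 0" "\<And>D. D division_of \<Union>D \<Longrightarrow> \<Union>D \<subseteq> {a..b} \<Longrightarrow>
    (\<Sum>K\<in>D. Sup K - Inf K) < d \<Longrightarrow> (\<Sum>K\<in>D. \<bar>f (Sup K) - f (Inf K)\<bar>) < e"
proof -
  have "\<exists>d>0. \<forall>D. D division_of \<Union>D \<and> \<Union>D \<subseteq> {a..b} \<and> (\<Sum>K\<in>D. Sup K - Inf K) < d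
        \<longrightarrow> (\<Sum>K\<in>D. \<bar>f (Sup K) - f (Inf K)\<bar>) < e"
    using assms unfolding abs_continuous_on_interval_def by simp
  then show thesis
    using that by blast
qed

lemma abs_continuous_on_interval_minus:
  assumes "abs_continuous_on_interval a b f"
  shows "abs_continuous_on_interval a b (\<lambda>t. - f t)"
proof -
  have "\<bar>- f u - - f v\<bar> = \<bar>f u - f v\<bar>" for u v
    by linarith
  with assms show ?thesis
    unfolding abs_continuous_on_interval_def by simp
qed

lemma division_of_real_memberE:
  fixes K :: "real set"
  assumes "D division_of S" "K \<in> D"
  obtains u v where "u \<le> v" "K = {u..v}" "Inf K = u" "Sup K = v"
proof -
  obtain u v where "K = cbox u v" "K \<noteq> {}"
    using division_ofD(3,4)[OF assms] by metis
  then show thesis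
    using that[of u v] by simp
qed

lemma lipschitz_imp_abs_continuous_on_interval:
  assumes "L-lipschitz_on {a..b} f"
  shows "abs_continuous_on_interval a b f"
  unfolding abs_continuous_on_interval_def
proof (intro allI impI)
  fix e :: real
  assume "0 < e"
  have L: "L \<ge> 0"
    using assms lipschitz_on_nonneg by blast
  show "\<exists>d>0. \<forall>D. D division_of \<Union>D \<and> \<Union>D \<subseteq> {a..b} \<and> (\<Sum>K\<in>D. Sup K - Inf K) < d
        \<longrightarrow> (\<Sum>K\<in>D. \<bar>f (Sup K) - f (Inf K)\<bar>) < e"
  proof (intro exI conjI allI impI)
    show "e / (L + 1) > 0"
      using L \<open>0 < e\<close> by simp
    fix D :: "real set set"
    assume "D division_of \<Union>D \<and> \<Union>D \<subseteq> {a..b} \<and> (\<Sum>K\<in>D. Sup K - Inf K) < e / (L + 1)"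
    then have D: "D division_of \<Union>D" "\<Union>D \<subseteq> {a..b}" "(\<Sum>K\<in>D. Sup K - Inf K) < e / (L + 1)"
      by auto
    have "\<bar>f (Sup K) - f (Inf K)\<bar> \<le> L * (Sup K - Inf K)" if "K \<in> D" for K
    proof -
      obtain u v where K: "u \<le> v" "K = {u..v}" "Inf K = u" "Sup K = v"
        using division_of_real_memberE[OF D(1) \<open>K \<in> D\<close>] .
      moreover have "K \<subseteq> {a..b}"
        using D that by blast
      ultimately have "u \<in> {a..b}" "v \<in> {a..b}"
        by auto
      then show ?thesis
        using lipschitz_onD[OF assms, of v u] K by (simp add: dist_real_def)
    qed
    then have "(\<Sum>K\<in>D. \<bar>f (Sup K) - f (Inf K)\<bar>) \<le> L * (\<Sum>K\<in>D. Sup K - Inf K)"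
      by (simp add: sum_distrib_left sum_mono)
    also have "\<dots> \<le> L * (e / (L + 1))"
      using D L by (intro mult_left_mono) auto
    also have "\<dots> < e"
      using L \<open>0 < e\<close> by (simp add: field_simps)
    finally show "(\<Sum>K\<in>D. \<bar>f (Sup K) - f (Inf K)\<bar>) < e" .
  qed
qed

lemma abs_continuous_on_interval_imp_continuous_on:
  assumes "abs_continuous_on_interval a b f"
  shows "continuous_on {a..b} f"
  unfolding continuous_on_iff
proof (intro ballI allI impI)
  fix x e :: real
  assume x: "x \<in> {a..b}" and "0 < e"
  then obtain d where d: "d > 0" and D: "\<And>D. D division_of \<Union>D \<Longrightarrow> \<Union>D \<subseteq> {a..b} \<Longrightarrow>
      (\<Sum>K\<in>D. Sup K - Inf K) < d \<Longrightarrow> (\<Sum>K\<in>D. \<bar>f (Sup K) - f (Inf K)\<bar>) < e"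
    using abs_continuous_on_intervalE[OF assms] by blast
  have *: "\<bar>f v - f u\<bar> < e" if "u \<in> {a..b}" "v \<in> {a..b}" "u \<le> v" "v - u < d" for u v
  proof -
    have "{{u..v}} division_of \<Union>{{u..v}}"
      using division_of_self[of u v] that by simp
    then show ?thesis
      using D[of "{{u..v}}"] that by simp
  qed
  have "dist (f y) (f x) < e" if "y \<in> {a..b}" "dist y x < d" for y
    using *[of x y] *[of y x] x that by (cases "x \<le> y") (auto simp: dist_real_def)
  with d show "\<exists>d>0. \<forall>y\<in>{a..b}. dist y x < d \<longrightarrow> dist (f y) (f x) < e"
    by blast
qed

section \<open>Increments and almost everywhere derivatives\<close>

text \<open>
  The interiors of the members of a division are pairwise disjoint, so their lengths add up to the
  measure of a subset of \<open>U\<close>.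
\<close>

lemma sum_length_division_le_measure:
  fixes D :: "real set set"
  assumes D: "D division_of S" and "S \<subseteq> U" "open U" "emeasure lebesgue U < \<infinity>"
  shows "(\<Sum>K\<in>D. Sup K - Inf K) \<le> measure lebesgue U"
proof -
  have "Sup K - Inf K = measure lebesgue (interior K)" if K: "K \<in> D" for K
  proof -
    obtain u v where "u \<le> v" "K = {u..v}" "Inf K = u" "Sup K = v"
      using division_of_real_memberE[OF D K] .
    then show ?thesis
      by (simp add: interior_atLeastAtMost_real)
  qed
  then have "(\<Sum>K\<in>D. Sup K - Inf K) = (\<Sum>K\<in>D. measure lebesgue (interior K))"
    by simp
  also have "\<dots> = measure lebesgue (\<Union>K\<in>D. interior K)"
  proof (rule measure_finite_Union[symmetric])
    show "finite D"
      using D by blast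
    show "interior ` D \<subseteq> sets lebesgue"
      by auto
    show "disjoint_family_on interior D"
      using division_ofD(5)[OF D] by (auto simp: disjoint_family_on_def)
    fix K assume "K \<in> D"
    then have "interior K \<subseteq> U"
      using division_ofD(2)[OF D] assms(2) interior_subset by blast
    then show "emeasure lebesgue (interior K) \<noteq> \<infinity>"
      using assms(3,4) emeasure_mono[of "interior K" U lebesgue] by (auto simp: top_unique less_top[symmetric])
  qed
  also have "\<dots> \<le> measure lebesgue U"
  proof (rule measure_mono_fmeasurable)
    show "(\<Union>K\<in>D. interior K) \<subseteq> U"
      using division_ofD(2)[OF D] assms(2) interior_subset by blast
    show "(\<Union>K\<in>D. interior K) \<in> sets lebesgue"
      using D by (intro sets.finite_UN) auto
    show "U \<in> lmeasurable"
      using assms(3,4) by (auto simp: fmeasurable_def)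
  qed
  finally show ?thesis .
qed

lemma null_set_outer_open:
  fixes N :: "real set"
  assumes "N \<in> null_sets lebesgue" "d > 0"
  obtains U where "open U" "N \<subseteq> U" "emeasure lebesgue U < \<infinity>" "measure lebesgue U < d"
proof -
  obtain U where U: "open U" "N \<subseteq> U" "emeasure lebesgue (U - N) < ennreal d"
    using sets_lebesgue_outer_open[OF null_setsD2[OF assms(1)] assms(2)] by blast
  have e: "emeasure lebesgue U = emeasure lebesgue (U - N)"
    using assms(1) U(1) by (subst emeasure_Diff_null_set) auto
  show thesis
  proof
    show fin: "emeasure lebesgue U < \<infinity>"
      using U(3) e by (simp add: order_less_trans[OF _ ennreal_less_top])
    have "emeasure lebesgue U = ennreal (measure lebesgue U)"
      using fin by (intro emeasure_eq_ennreal_measure) auto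
    then show "measure lebesgue U < d"
      using U(3) e by (simp add: ennreal_less_iff)
  qed (use U in auto)
qed

lemma AE_lebesgue_on_interval_null:
  fixes a b :: real
  assumes "AE t in lebesgue_on {a..b}. P t"
  obtains N where "N \<in> null_sets lebesgue" "\<And>t. t \<in> {a..b} - N \<Longrightarrow> P t"
proof -
  have "AE t in lebesgue. t \<in> {a..b} \<longrightarrow> P t"
    using assms by (subst (asm) AE_restrict_space_iff) auto
  then show thesis
    by (rule AE_E3) (use that in auto)
qed

lemma AE_lebesgue_on_interval_subset:
  fixes a b :: real
  assumes "AE t in lebesgue_on {a..b}. P t" "a \<le> a'" "b' \<le> b"
  shows "AE t in lebesgue_on {a'..b'}. P t"
  using assms by (auto simp: AE_restrict_space_iff elim!: eventually_mono)

text \<open>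
  Let \<open>N\<close> be the null set where the bound on the derivative fails. The gauge asks that an interval
  with tag \<open>t \<notin> N\<close> be so short that \<open>f\<close> grows on it at most with slope \<open>k + e\<close>, and that an interval
  with tag in \<open>N\<close> lie in an open set \<open>U \<supseteq> N\<close> of small measure. By Cousin's lemma there is a tagged
  division that is fine for this gauge. In the telescoping sum of the increments of \<open>f\<close>, the tags outside
  \<open>N\<close> contribute at most \<open>k + e\<close> times the length, and the tags in \<open>N\<close> contribute less than \<open>e\<close> by
  absolute continuity, because their intervals have small total length.
\<close>

lemma abs_continuous_increment_le:
  assumes ab: "a \<le> b" and ac: "abs_continuous_on_interval a b f"
    and ae: "AE t in lebesgue_on {a..b}. \<exists>v. (f has_real_derivative v) (at t) \<and> v \<le> k"
  shows "f b - f a \<le> k * (b - a)"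
proof -
  obtain N where N: "N \<in> null_sets lebesgue"
    and der: "\<And>t. t \<in> {a..b} - N \<Longrightarrow> \<exists>v. (f has_real_derivative v) (at t) \<and> v \<le> k"
    using AE_lebesgue_on_interval_null[OF ae] by blast
  have approx: "f b - f a - k * (b - a) \<le> e * (b - a + 2 + \<bar>k\<bar>)" if e: "0 < e" "e \<le> 1" for e
  proof -
    obtain d0 where d0: "d0 > 0" and ac': "\<And>D. D division_of \<Union>D \<Longrightarrow> \<Union>D \<subseteq> {a..b} \<Longrightarrow>
        (\<Sum>K\<in>D. Sup K - Inf K) < d0 \<Longrightarrow> (\<Sum>K\<in>D. \<bar>f (Sup K) - f (Inf K)\<bar>) < e"
      using abs_continuous_on_intervalE[OF ac e(1)] by blast
    obtain U where U: "open U" "N \<subseteq> U" "emeasure lebesgue U < \<infinity>" "measure lebesgue U < min d0 e"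
      using null_set_outer_open[OF N, of "min d0 e"] d0 e by (metis min_less_iff_conj)
    have "\<exists>d>0. \<forall>u w. u \<le> t \<and> t \<le> w \<and> u \<in> ball t d \<and> w \<in> ball t d \<longrightarrow>
        f w - f u \<le> (k + e) * (w - u)" if t: "t \<in> {a..b} - N" for t
    proof -
      obtain v where v: "(f has_real_derivative v) (at t)" "v \<le> k"
        using der[OF t] by blast
      then obtain d where d: "d > 0"
        "\<And>y. \<bar>y - t\<bar> < d \<Longrightarrow> \<bar>f y - f t - v * (y - t)\<bar> \<le> e * \<bar>y - t\<bar>"
        using e unfolding has_field_derivative_def has_derivative_at_alt
        by (auto simp: mult.commute)
      have "f w - f u \<le> (k + e) * (w - u)"
        if "u \<le> t" "t \<le> w" "u \<in> ball t d" "w \<in> ball t d" for u w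
      proof -
        have "f w - f t - v * (w - t) \<le> e * (w - t)" "- (f u - f t - v * (u - t)) \<le> e * (t - u)"
          using d(2)[of w] d(2)[of u] that by (auto simp: dist_real_def)
        then have "f w - f u \<le> (v + e) * (w - u)"
          by (simp add: algebra_simps)
        also have "\<dots> \<le> (k + e) * (w - u)"
          using v(2) that by (intro mult_right_mono) auto
        finally show ?thesis .
      qed
      with d(1) show ?thesis by blast
    qed
    then obtain d where d: "\<And>t. t \<in> {a..b} - N \<Longrightarrow> d t > 0"
      "\<And>t u w. t \<in> {a..b} - N \<Longrightarrow> u \<le> t \<Longrightarrow> t \<le> w \<Longrightarrow> u \<in> ball t (d t) \<Longrightarrow> w \<in> ball t (d t) \<Longrightarrow>
        f w - f u \<le> (k + e) * (w - u)"
      by metis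
    \<comment> \<open>Tags always lie in \<open>[a, b]\<close>; the value \<open>UNIV\<close> elsewhere only makes the gauge total.\<close>
    define g where "g t = (if t \<in> N then U else if t \<in> {a..b} then ball t (d t) else UNIV)" for t
    have "gauge g"
      using U(1,2) d(1) by (auto simp: gauge_def g_def)
    then obtain p where p: "p tagged_division_of {a..b}" "g fine p"
      using fine_division_exists_real by blast
    define B where "B = {(t, K) \<in> p. t \<in> N}"
    have "finite p" "B \<subseteq> p"
      using p(1) by (auto simp: B_def)
    have B: "B tagged_division_of \<Union>(snd ` B)"
      by (metis B_def \<open>B \<subseteq> p\<close> p(1) tagged_division_of_def tagged_partial_division_of_Union_self
          tagged_partial_division_subset)
    then have divB: "snd ` B division_of \<Union>(snd ` B)"
      by (rule division_of_tagged_division)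
    have B_ab: "\<Union>(snd ` B) \<subseteq> {a..b}"
      using \<open>B \<subseteq> p\<close> p(1) by fastforce
    have B_U: "\<Union>(snd ` B) \<subseteq> U"
      using p(2) by (fastforce simp: B_def fine_def g_def)
    have len: "(\<Sum>K\<in>snd ` B. Sup K - Inf K) < min d0 e"
      using sum_length_division_le_measure[OF divB B_U U(1,3)] U(4) by linarith
    have inc: "(\<Sum>K\<in>snd ` B. \<bar>f (Sup K) - f (Inf K)\<bar>) < e"
      using ac'[OF divB B_ab] len by simp
    have shape: "\<exists>u w. u \<le> t \<and> t \<le> w \<and> K = {u..w}" if "(t, K) \<in> p" for t K
      using tagged_division_ofD(2,4)[OF p(1) that] by (metis atLeastAtMost_iff cbox_interval)
    \<comment> \<open>A degenerate interval may carry several tags, so a sum over tagged intervals equals the sum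
      over intervals only for summands that vanish on singletons. The auxiliary \<open>h'\<close> also vanishes
      on the empty set, where \<open>Sup\<close> and \<open>Inf\<close> are unspecified.\<close>
    have tag_sum: "(\<Sum>(t, K)\<in>B. h K) = sum h (snd ` B)" if "\<And>u. h {u} = 0" for h :: "real set \<Rightarrow> real"
    proof -
      define h' where "h' K = (if K = {} then 0 else h K)" for K
      have ne: "K \<noteq> {}" if "(t, K) \<in> B" for t K
        using shape[of t K] that \<open>B \<subseteq> p\<close> by fastforce
      have "(\<Sum>(t, K)\<in>B. h' K) = sum h' (snd ` B)"
      proof (rule sum.over_tagged_division_lemma[OF B])
        fix u v :: real
        assume "box u v = {}"
        then have "cbox u v = {} \<or> cbox u v = {u}"
          by (auto simp: box_eq_empty)
        with that show "h' (cbox u v) = 0"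
          unfolding h'_def by metis
      qed
      moreover have "(\<Sum>(t, K)\<in>B. h' K) = (\<Sum>(t, K)\<in>B. h K)"
        by (rule sum.cong) (use ne in \<open>auto simp: h'_def\<close>)
      moreover have "sum h' (snd ` B) = sum h (snd ` B)"
        by (rule sum.cong) (use ne in \<open>auto simp: h'_def\<close>)
      ultimately show ?thesis by simp
    qed
    \<comment> \<open>\<open>r\<close> is the excess of the increment over one of slope \<open>k + e\<close>; on the tags in \<open>N\<close> it is
      estimated in absolute value, since \<open>k + e\<close> may be negative.\<close>
    define r where "r = (\<lambda>(t::real, K). f (Sup K) - f (Inf K) - (k + e) * (Sup K - Inf K))"
    have good: "r q \<le> 0" if q: "q \<in> p - B" for q
    proof -
      obtain t K where tK: "q = (t, K)" "(t, K) \<in> p" "t \<notin> N"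
        using q by (cases q) (auto simp: B_def)
      obtain u w where uw: "u \<le> t" "t \<le> w" "K = {u..w}"
        using shape[OF tK(2)] by blast
      have t: "t \<in> {a..b} - N"
        using tag_in_interval[OF p(1) tK(2)] tK(3) by simp
      have "K \<subseteq> ball t (d t)"
        using fineD[OF p(2) tK(2)] t by (simp add: g_def)
      moreover have "u \<in> K" "w \<in> K"
        using uw by auto
      ultimately have "u \<in> ball t (d t)" "w \<in> ball t (d t)"
        by blast+
      then have "f w - f u \<le> (k + e) * (w - u)"
        using d(2)[OF t uw(1,2)] by blast
      then show ?thesis
        using uw tK(1) by (simp add: r_def)
    qed
    have bad: "r q \<le> (case q of (t, K) \<Rightarrow> \<bar>f (Sup K) - f (Inf K)\<bar>)
        + \<bar>k + e\<bar> * (case q of (t, K) \<Rightarrow> Sup K - Inf K)" if q: "q \<in> B" for q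
    proof -
      obtain t K where tK: "q = (t, K)" "(t, K) \<in> p"
        using q \<open>B \<subseteq> p\<close> by (cases q) auto
      obtain u w where uw: "u \<le> t" "t \<le> w" "K = {u..w}"
        using shape[OF tK(2)] by blast
      have "- ((k + e) * (w - u)) \<le> \<bar>(k + e) * (w - u)\<bar>"
        by (rule abs_ge_minus_self)
      also have "\<dots> = \<bar>k + e\<bar> * (w - u)"
        using uw by (simp add: abs_mult)
      finally have "f w - f u - (k + e) * (w - u) \<le> \<bar>f w - f u\<bar> + \<bar>k + e\<bar> * (w - u)"
        by linarith
      then show ?thesis
        using uw tK(1) by (simp add: r_def)
    qed
    have "sum r p = sum r (p - B) + sum r B"
      using \<open>finite p\<close> \<open>B \<subseteq> p\<close> by (simp add: sum.subset_diff)
    also have "\<dots> \<le> 0 + sum r B"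
      using good by (intro add_right_mono sum_nonpos) auto
    also have "sum r B \<le> (\<Sum>(t, K)\<in>B. \<bar>f (Sup K) - f (Inf K)\<bar>) + \<bar>k + e\<bar> * (\<Sum>(t, K)\<in>B. Sup K - Inf K)"
      using sum_mono[OF bad] by (simp add: sum.distrib sum_distrib_left)
    also have "\<dots> \<le> e + \<bar>k + e\<bar> * e"
      using len inc by (intro add_mono mult_left_mono) (auto simp: tag_sum)
    also have "\<dots> \<le> e * (2 + \<bar>k\<bar>)"
    proof -
      have "\<bar>k + e\<bar> * e \<le> (1 + \<bar>k\<bar>) * e"
        using e by (intro mult_right_mono) auto
      then show ?thesis by (simp add: algebra_simps)
    qed
    finally have "sum r p \<le> e * (2 + \<bar>k\<bar>)"
      by simp
    moreover have "sum r p = (f b - f a) - (k + e) * (b - a)"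
    proof -
      have "sum r p = (\<Sum>(t, K)\<in>p. f (Sup K) - f (Inf K)) - (k + e) * (\<Sum>(t, K)\<in>p. Sup K - Inf K)"
        by (simp add: r_def case_prod_unfold sum_subtractf flip: sum_distrib_left)
      then show ?thesis
        using additive_tagged_division_1[OF ab p(1), of f]
          additive_tagged_division_1[OF ab p(1), of "\<lambda>x. x"] by simp
    qed
    ultimately show ?thesis
      by (simp add: algebra_simps)
  qed
  show ?thesis
  proof (rule ccontr)
    define X where "X = f b - f a - k * (b - a)"
    define C where "C = b - a + 2 + \<bar>k\<bar>"
    assume "\<not> ?thesis"
    then have X: "X > 0" and C: "C > 0"
      using ab by (auto simp: X_def C_def)
    \<comment> \<open>The value \<open>e = X / (2 C)\<close> turns \<open>X \<le> e C\<close> into \<open>X \<le> X / 2\<close>.\<close>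
    have "min 1 (X / (2 * C)) * C \<le> X / (2 * C) * C"
      using C by (intro mult_right_mono) auto
    moreover have "X \<le> min 1 (X / (2 * C)) * C"
      using approx[of "min 1 (X / (2 * C))"] X C by (simp add: X_def C_def)
    ultimately show False
      using X C by simp
  qed
qed


lemma abs_continuous_increment_eq:
  assumes ab: "a \<le> b" and ac: "abs_continuous_on_interval a b f"
    and ae: "AE t in lebesgue_on {a..b}. (f has_real_derivative k) (at t)"
  shows "f b = f a + k * (b - a)"
proof -
  have "f b - f a \<le> k * (b - a)"
    using ae by (intro abs_continuous_increment_le[OF ab ac]) (auto elim!: eventually_mono)
  moreover have "AE t in lebesgue_on {a..b}. \<exists>v. ((\<lambda>t. - f t) has_real_derivative v) (at t) \<and> v \<le> - k"
    using ae by eventually_elim (auto intro!: exI[of _ "- k"] derivative_intros)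
  then have "- f b - - f a \<le> - k * (b - a)"
    by (rule abs_continuous_increment_le[OF ab abs_continuous_on_interval_minus[OF ac]])
  ultimately show ?thesis by simp
qed

section \<open>Trajectories that cannot reach a barrier\<close>

lemma AE_lebesgue_neq: "AE x in lebesgue. x \<noteq> (p::real)"
  by (rule AE_I'[of "{p}"]) auto

text \<open>
  The function is only controlled above the line of slope \<open>k\<close> through \<open>(a, m)\<close>, but this suffices: up to
  the first time at which it would reach that line, it has slope \<open>k\<close> itself, so it runs parallel to the
  line and keeps its initial positive distance \<open>\<gamma>(a) - m\<close>.
\<close>

lemma abs_continuous_stays_above_line:
  assumes ac: "abs_continuous_on_interval a b \<gamma>" and start: "m < \<gamma> a"
    and ae: "AE t in lebesgue_on {a..b}. m + k * (t - a) < \<gamma> t \<longrightarrow> (\<gamma> has_real_derivative k) (at t)"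
    and t: "t \<in> {a..b}"
  shows "\<gamma> t = \<gamma> a + k * (t - a)"
proof -
  have straight: "\<gamma> t = \<gamma> a + k * (t - a)"
    if t: "t \<in> {a..b}" and above: "\<And>r. r \<in> {a..<t} \<Longrightarrow> m + k * (r - a) < \<gamma> r" for t
  proof (rule abs_continuous_increment_eq)
    show "abs_continuous_on_interval a t \<gamma>"
      using abs_continuous_on_interval_subset[OF ac] t by simp
    have "AE r in lebesgue_on {a..t}. r \<noteq> t"
      using AE_lebesgue_neq[of t] by (auto simp: AE_restrict_space_iff elim!: eventually_mono)
    moreover have "AE r in lebesgue_on {a..t}. m + k * (r - a) < \<gamma> r \<longrightarrow> (\<gamma> has_real_derivative k) (at r)"
      using AE_lebesgue_on_interval_subset[OF ae] t by simp
    moreover have "AE r in lebesgue_on {a..t}. r \<in> {a..t}"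
      using AE_space[of "lebesgue_on {a..t}"] by simp
    ultimately show "AE r in lebesgue_on {a..t}. (\<gamma> has_real_derivative k) (at r)"
      by eventually_elim (use above in auto)
  qed (use t in auto)
  \<comment> \<open>\<open>S\<close> collects the times at or below the line. The case \<open>t = Inf S\<close> of \<open>straight\<close> contradicts
    \<open>Inf S \<in> S\<close>; once \<open>S\<close> is empty, \<open>straight\<close> applies at all times.\<close>
  define S where "S = {t \<in> {a..b}. \<gamma> t \<le> m + k * (t - a)}"
  have "S = {}"
  proof (rule ccontr)
    assume "S \<noteq> {}"
    have "closed S"
      unfolding S_def
      by (intro continuous_on_closed_Collect_le abs_continuous_on_interval_imp_continuous_on[OF ac]
          continuous_intros)
    moreover have bdd: "bdd_below S"
      by (rule bdd_belowI[of _ a]) (auto simp: S_def)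
    ultimately have first: "Inf S \<in> S"
      using \<open>S \<noteq> {}\<close> closed_contains_Inf by blast
    have "m + k * (r - a) < \<gamma> r" if "r \<in> {a..<Inf S}" for r
    proof (rule ccontr)
      assume "\<not> ?thesis"
      with that first have "r \<in> S"
        by (auto simp: S_def)
      then show False
        using cInf_lower[OF _ bdd] that by fastforce
    qed
    then have "\<gamma> (Inf S) = \<gamma> a + k * (Inf S - a)"
      using straight[of "Inf S"] first by (auto simp: S_def)
    then show False
      using first start by (auto simp: S_def)
  qed
  then have "m + k * (r - a) < \<gamma> r" if "r \<in> {a..b}" for r
    using that unfolding S_def by fastforce
  with t show ?thesis
    by (intro straight) auto
qed

lemma abs_continuous_stays_below_line:
  assumes ac: "abs_continuous_on_interval a b \<gamma>" and start: "\<gamma> a < m"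
    and ae: "AE t in lebesgue_on {a..b}. \<gamma> t < m + k * (t - a) \<longrightarrow> (\<gamma> has_real_derivative k) (at t)"
    and t: "t \<in> {a..b}"
  shows "\<gamma> t = \<gamma> a + k * (t - a)"
proof -
  have "AE t in lebesgue_on {a..b}. - m + - k * (t - a) < - \<gamma> t
      \<longrightarrow> ((\<lambda>t. - \<gamma> t) has_real_derivative - k) (at t)"
    using ae by eventually_elim (auto intro: DERIV_minus)
  from abs_continuous_stays_above_line[OF abs_continuous_on_interval_minus[OF ac] _ this t]
  show ?thesis
    using start by simp
qed

section \<open>The front and its flow\<close>

lemma envelopes_locally_constant:
  assumes "open U" "x \<in> U" "\<And>y. y \<in> U \<Longrightarrow> f y = v"
  shows "lsc_env f x = ereal v" "usc_env f x = ereal v"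
proof -
  have ev: "eventually (\<lambda>y. ereal (f y) = ereal v) (nhds x)"
    using assms by (auto simp: eventually_nhds)
  show "lsc_env f x = ereal v"
    unfolding lsc_env_def using Liminf_eq[OF ev] by (simp add: Liminf_const)
  show "usc_env f x = ereal v"
    unfolding usc_env_def using Limsup_eq[OF ev] by (simp add: Limsup_const)
qed

lemma envelopes_step:
  fixes p x :: real
  shows "p < x \<Longrightarrow> lsc_env (\<lambda>y. - indicat_real {..p} y) x = 0"
    and "p < x \<Longrightarrow> usc_env (\<lambda>y. - indicat_real {..p} y) x = 0"
    and "x < p \<Longrightarrow> lsc_env (\<lambda>y. - indicat_real {..p} y) x = - 1"
    and "x < p \<Longrightarrow> usc_env (\<lambda>y. - indicat_real {..p} y) x = - 1"
  using envelopes_locally_constant[of "{p<..}" x "\<lambda>y. - indicat_real {..p} y" 0]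
    envelopes_locally_constant[of "{..<p}" x "\<lambda>y. - indicat_real {..p} y" "- 1"]
  by (auto simp: one_ereal_def)

lemma linear_growth_minus:
  assumes "linear_growth T f"
  shows "linear_growth T (\<lambda>t x. - f t x)"
proof -
  have "(\<lambda>(t, x). - f t x / (1 + \<bar>x\<bar>)) = (\<lambda>p. - (\<lambda>(t, x). f t x / (1 + \<bar>x\<bar>)) p)"
    by (auto simp: fun_eq_iff)
  with assms show ?thesis
    unfolding linear_growth_def by (simp add: borel_measurable_uminus)
qed

text \<open>
  Measurability in \<open>(t, x)\<close> jointly holds because the set \<open>{x \<le> c(t)}\<close> is closed in the strip
  \<open>[0, T] \<times> \<real>\<close>.
\<close>

lemma linear_growth_subgraph_indicator:
  assumes "continuous_on {0..T} c"
  shows "linear_growth T (\<lambda>t. indicat_real {..c t})"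
proof -
  define C where "C = {p \<in> {0..T} \<times> (UNIV::real set). snd p \<le> c (fst p)}"
  have "continuous_on ({0..T} \<times> (UNIV::real set)) (\<lambda>p. c (fst p))"
    by (rule continuous_on_compose2[OF assms continuous_on_fst]) auto
  then have "closed C"
    unfolding C_def by (intro continuous_on_closed_Collect_le continuous_intros closed_Times) auto
  then have "(\<lambda>p. indicat_real C p / (1 + \<bar>snd p\<bar>)) \<in> borel_measurable (borel :: (real \<times> real) measure)"
    by (intro borel_measurable_divide borel_measurable_indicator borel_closed
        borel_measurable_continuous_onI continuous_intros)
  then have "(\<lambda>p. indicat_real C p / (1 + \<bar>snd p\<bar>)) \<in> borel_measurable (lebesgue_on ({0..T} \<times> UNIV))"
    by (intro measurable_restrict_space1 measurable_completion) auto
  also have "?this \<longleftrightarrow> (\<lambda>(t, x). indicat_real {..c t} x / (1 + \<bar>x\<bar>)) \<in> borel_measurable (lebesgue_on ({0..T} \<times> UNIV))"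
    by (rule measurable_cong) (auto simp: C_def indicator_def)
  finally have "(\<lambda>(t, x). indicat_real {..c t} x / (1 + \<bar>x\<bar>)) \<in> borel_measurable (lebesgue_on ({0..T} \<times> UNIV))" .
  moreover have "AE (t, x) in lebesgue_on ({0..T} \<times> UNIV). \<bar>indicat_real {..c t} x / (1 + \<bar>x\<bar>)\<bar> \<le> 1"
    by (intro AE_I2) (auto simp: indicator_def)
  ultimately show ?thesis
    unfolding linear_growth_def by blast
qed

text \<open>
  To the right of the front, particles rest; to its left they move with velocity \<open>-1\<close>. The one
  particle that starts on the front is counted as lying to the left, as in the set \<open>{x \<le> c(t)}\<close>.
\<close>

definition front_flow :: "(real \<Rightarrow> real) \<Rightarrow> real \<Rightarrow> real \<Rightarrow> real \<Rightarrow> real" where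
  "front_flow c t s x = (if c s < x then x else x - (t - s))"

text \<open>
  The assumptions say that the front moves left with speed at most \<open>1\<close>. Each of them handles one side:
  that \<open>c\<close> is nonincreasing keeps the particles on the right away from the front, and the bound on the
  speed keeps those on the left away from it. The barriers are the level \<open>c(s)\<close> and the line
  \<open>c(s) - (t - s)\<close>, which lie on the same side of the front as the particles concerned.
\<close>

lemma regular_lagrangian_flow_front:
  assumes anti: "\<And>s t. 0 \<le> s \<Longrightarrow> s \<le> t \<Longrightarrow> t \<le> T \<Longrightarrow> c t \<le> c s"
    and slope: "\<And>s t. 0 \<le> s \<Longrightarrow> s \<le> t \<Longrightarrow> t \<le> T \<Longrightarrow> c s - (t - s) \<le> c t"
  shows "regular_lagrangian_flow T (\<lambda>t x. - indicat_real {..c t} x) (front_flow c)"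
  unfolding regular_lagrangian_flow_def
proof
  fix s assume s: "s \<in> {0..T}"
  let ?b = "\<lambda>t x. - indicat_real {..c t} x"
  have above: "inclusion_solution T ?b s x (\<lambda>t. front_flow c t s x) \<and>
      (\<forall>\<gamma>. inclusion_solution T ?b s x \<gamma> \<longrightarrow> (\<forall>t\<in>{s..T}. \<gamma> t = front_flow c t s x))"
    if x: "c s < x" for x
  proof (intro conjI allI impI ballI)
    have [simp]: "front_flow c t s x = x" for t
      using x by (simp add: front_flow_def)
    have "c t < x" if "t \<in> {s..T}" for t
      using anti[of s t] that s x by auto
    then have "AE t in lebesgue_on {s..T}. \<exists>v. ((\<lambda>t. x) has_real_derivative v) (at t) \<and>
        lsc_env (?b t) x \<le> ereal v \<and> ereal v \<le> usc_env (?b t) x"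
      by (intro AE_I2 exI[of _ 0]) (auto simp: envelopes_step)
    moreover have "abs_continuous_on_interval s T (\<lambda>t. x)"
      by (rule lipschitz_imp_abs_continuous_on_interval[of 0]) (auto intro!: lipschitz_onI)
    ultimately show "inclusion_solution T ?b s x (\<lambda>t. front_flow c t s x)"
      unfolding inclusion_solution_def by simp
  next
    fix \<gamma> t assume \<gamma>: "inclusion_solution T ?b s x \<gamma>" and t: "t \<in> {s..T}"
    have "\<gamma> t = \<gamma> s + 0 * (t - s)"
    proof (rule abs_continuous_stays_above_line[where m = "c s"])
      have "AE t in lebesgue_on {s..T}. t \<in> {s..T}"
        using AE_space[of "lebesgue_on {s..T}"] by simp
      moreover have "AE t in lebesgue_on {s..T}. \<exists>v. (\<gamma> has_real_derivative v) (at t) \<and>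
          lsc_env (?b t) (\<gamma> t) \<le> ereal v \<and> ereal v \<le> usc_env (?b t) (\<gamma> t)"
        using \<gamma> by (simp add: inclusion_solution_def)
      ultimately show "AE t in lebesgue_on {s..T}. c s + 0 * (t - s) < \<gamma> t
          \<longrightarrow> (\<gamma> has_real_derivative 0) (at t)"
      proof eventually_elim
        case (elim t)
        show ?case
        proof
          assume "c s + 0 * (t - s) < \<gamma> t"
          then have "c t < \<gamma> t"
            using anti[of s t] elim(1) s by auto
          with elim(2) show "(\<gamma> has_real_derivative 0) (at t)"
            by (auto simp: envelopes_step dest!: antisym)
        qed
      qed
    qed (use \<gamma> x t in \<open>auto simp: inclusion_solution_def\<close>)
    then show "\<gamma> t = front_flow c t s x"
      using \<gamma> x by (simp add: front_flow_def inclusion_solution_def)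
  qed
  have below: "inclusion_solution T ?b s x (\<lambda>t. front_flow c t s x) \<and>
      (\<forall>\<gamma>. inclusion_solution T ?b s x \<gamma> \<longrightarrow> (\<forall>t\<in>{s..T}. \<gamma> t = front_flow c t s x))"
    if x: "x < c s" for x
  proof (intro conjI allI impI ballI)
    have [simp]: "front_flow c t s x = x - (t - s)" for t
      using x by (simp add: front_flow_def)
    have "x - (t - s) < c t" if "t \<in> {s..T}" for t
      using slope[of s t] that s x by auto
    moreover have "((\<lambda>t. x - (t - s)) has_real_derivative - 1) (at t)" for t
      by (auto intro!: derivative_eq_intros)
    ultimately have "AE t in lebesgue_on {s..T}. \<exists>v. ((\<lambda>t. x - (t - s)) has_real_derivative v) (at t) \<and>
        lsc_env (?b t) (x - (t - s)) \<le> ereal v \<and> ereal v \<le> usc_env (?b t) (x - (t - s))"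
      by (intro AE_I2 exI[of _ "- 1"]) (auto simp: envelopes_step one_ereal_def)
    moreover have "abs_continuous_on_interval s T (\<lambda>t. x - (t - s))"
      by (rule lipschitz_imp_abs_continuous_on_interval[of 1])
        (auto intro!: lipschitz_onI simp: dist_real_def)
    ultimately show "inclusion_solution T ?b s x (\<lambda>t. front_flow c t s x)"
      unfolding inclusion_solution_def by simp
  next
    fix \<gamma> t assume \<gamma>: "inclusion_solution T ?b s x \<gamma>" and t: "t \<in> {s..T}"
    have "\<gamma> t = \<gamma> s + - 1 * (t - s)"
    proof (rule abs_continuous_stays_below_line[where m = "c s"])
      have "AE t in lebesgue_on {s..T}. t \<in> {s..T}"
        using AE_space[of "lebesgue_on {s..T}"] by simp
      moreover have "AE t in lebesgue_on {s..T}. \<exists>v. (\<gamma> has_real_derivative v) (at t) \<and>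
          lsc_env (?b t) (\<gamma> t) \<le> ereal v \<and> ereal v \<le> usc_env (?b t) (\<gamma> t)"
        using \<gamma> by (simp add: inclusion_solution_def)
      ultimately show "AE t in lebesgue_on {s..T}. \<gamma> t < c s + - 1 * (t - s)
          \<longrightarrow> (\<gamma> has_real_derivative - 1) (at t)"
      proof eventually_elim
        case (elim t)
        show ?case
        proof
          assume "\<gamma> t < c s + - 1 * (t - s)"
          then have left: "\<gamma> t < c t"
            using slope[of s t] elim(1) s by auto
          from elim(2) obtain v where v: "(\<gamma> has_real_derivative v) (at t)"
            "ereal (- 1) \<le> ereal v" "ereal v \<le> ereal (- 1)"
            by (auto simp: envelopes_step[OF left] envelopes_step(3,4)[OF left] one_ereal_def)
          then show "(\<gamma> has_real_derivative - 1) (at t)"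
            by (metis antisym ereal_less_eq(3))
        qed
      qed
    qed (use \<gamma> x t in \<open>auto simp: inclusion_solution_def\<close>)
    then show "\<gamma> t = front_flow c t s x"
      using \<gamma> x by (simp add: front_flow_def inclusion_solution_def)
  qed
  show "AE x in lebesgue. inclusion_solution T ?b s x (\<lambda>t. front_flow c t s x) \<and>
      (\<forall>\<gamma>. inclusion_solution T ?b s x \<gamma> \<longrightarrow> (\<forall>t\<in>{s..T}. \<gamma> t = front_flow c t s x))"
    using AE_lebesgue_neq[of "c s"]
  proof eventually_elim
    case (elim x)
    then show ?case
      using above[of x] below[of x] by (cases "c s < x") auto
  qed
qed

section \<open>The indicator of the region to the left of the front\<close>

theorem proposition5p4:
  fixes T :: real and c :: "real \<Rightarrow> real"
  assumes "T > 0"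
    and "\<exists>L. L-lipschitz_on {0..T} c"
    and "c T = 0"
    and "AE t in lebesgue_on {0..T}. c differentiable at t \<and> - deriv c t \<in> {0..1}"
  shows "burgers_solution T (indicat_real {..0}) (\<lambda>t. indicat_real {..c t})"
proof -
  obtain L where L: "L-lipschitz_on {0..T} c"
    using assms(2) by blast
  have ac: "abs_continuous_on_interval s t c" if "0 \<le> s" "t \<le> T" for s t
    using abs_continuous_on_interval_subset[OF lipschitz_imp_abs_continuous_on_interval[OF L]] that .
  have "AE t in lebesgue_on {0..T}. (c has_real_derivative deriv c t) (at t) \<and> - 1 \<le> deriv c t \<and> deriv c t \<le> 0"
    using assms(4) by eventually_elim (auto simp: DERIV_deriv_iff_real_differentiable)
  then have der: "AE r in lebesgue_on {s..t}. (c has_real_derivative deriv c r) (at r) \<and> - 1 \<le> deriv c r \<and> deriv c r \<le> 0"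
    if "0 \<le> s" "t \<le> T" for s t
    using AE_lebesgue_on_interval_subset that by blast
  have anti: "c t \<le> c s" if "0 \<le> s" "s \<le> t" "t \<le> T" for s t
  proof -
    have "c t - c s \<le> 0 * (t - s)"
    proof (rule abs_continuous_increment_le[OF that(2) ac[OF that(1,3)]])
      show "AE r in lebesgue_on {s..t}. \<exists>v. (c has_real_derivative v) (at r) \<and> v \<le> 0"
        using der[OF that(1,3)] by eventually_elim blast
    qed
    then show ?thesis by simp
  qed
  have slope: "c s - (t - s) \<le> c t" if "0 \<le> s" "s \<le> t" "t \<le> T" for s t
  proof -
    have "- c t - - c s \<le> 1 * (t - s)"
    proof (rule abs_continuous_increment_le[OF that(2) abs_continuous_on_interval_minus[OF ac[OF that(1,3)]]])
      show "AE r in lebesgue_on {s..t}. \<exists>v. ((\<lambda>r. - c r) has_real_derivative v) (at r) \<and> v \<le> 1"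
        using der[OF that(1,3)]
      proof eventually_elim
        case (elim r)
        then show ?case
          by (intro exI[of _ "- deriv c r"]) (auto intro: DERIV_minus)
      qed
    qed
    then show ?thesis by simp
  qed
  have growth: "linear_growth T (\<lambda>t. indicat_real {..c t})"
    using linear_growth_subgraph_indicator[OF lipschitz_on_continuous_on[OF L]] .
  have "indicat_real {..c t} x = indicat_real {..0} (front_flow c T t x)"
    if "t \<in> {0..T}" "x \<noteq> c t" for t x
    using anti[of t T] slope[of t T] that assms(3) by (auto simp: front_flow_def indicator_def)
  then have repr: "AE x in lebesgue. indicat_real {..c t} x = indicat_real {..0} (front_flow c T t x)"
    if "t \<in> {0..T}" for t
    using AE_lebesgue_neq[of "c t"] that by (auto elim!: eventually_mono)
  have "transport_solution T (\<lambda>t x. - indicat_real {..c t} x) (indicat_real {..0}) (\<lambda>t. indicat_real {..c t})"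
    unfolding transport_solution_def
  proof (intro conjI exI[of _ "front_flow c"] ballI)
    show "mono (\<lambda>x. - indicat_real {..c t} x)" for t
      by (rule monoI) (auto simp: indicator_def)
  qed (use regular_lagrangian_flow_front[OF anti slope] linear_growth_minus[OF growth] repr in auto)
  moreover have "locally_bounded T (\<lambda>t. indicat_real {..c t})"
    unfolding locally_bounded_def bounded_iff by (intro allI impI exI[of _ 1]) (auto simp: indicator_def)
  moreover have "antimono (indicat_real {..c t})" for t
    by (rule antimonoI) (auto simp: indicator_def)
  ultimately show ?thesis
    using growth by (simp add: burgers_solution_def)
qed

end
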